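(* Let $\Sigma$ be a finite alphabet and $\mathbb{D}$ a value domain. For every property $\varPhi : \Sigma^\omega \to \mathbb{D}$, the following statements hold. (1) $\mathit{SafetyCl}(\varPhi)$ is safe. (2) $\mathit{SafetyCl}(\varPhi)(w) \geq \varPhi(w)$ for all $w \in \Sigma^\omega$. (3) $\mathit{SafetyCl}(\varPhi)(w) = \mathit{SafetyCl}(\mathit{SafetyCl}(\varPhi))(w)$ for all $w \in \Sigma^\omega$. (4) $\varPhi$ is safe if and only if $\varPhi(w) = \mathit{SafetyCl}(\varPhi)(w)$ for all $w \in \Sigma^\omega$. (5) For every safe property $\varPsi : \Sigma^\omega \to \mathbb{D}$, if $\varPhi(w) \leq \varPsi(w)$ for all $w \in \Sigma^\omega$, then $\mathit{SafetyCl}(\varPhi)(w) \leq \varPsi(w)$ for all $w \in \Sigma^\omega$.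
   Context: $\Sigma^*$ and $\Sigma^\omega$ are the sets of finite and infinite words over the finite nonempty alphabet $\Sigma$; $u \prec w$ means that the finite word $u$ is a strict prefix of $w$ (the empty word is allowed). A value domain $\mathbb{D}$ is a complete lattice with $\bot \neq \top$. A property is a total function $\varPhi : \Sigma^\omega \to \mathbb{D}$. $\varPhi$ is safe when for every $w \in \Sigma^\omega$ and $v \in \mathbb{D}$ with $\varPhi(w) \not\geq v$, there is a prefix $u \prec w$ such that $\sup_{w' \in \Sigma^\omega} \varPhi(uw') \not\geq v$. The safety closure of $\varPhi$ is the property $\mathit{SafetyCl}(\varPhi) : \Sigma^\omega \to \mathbb{D}$ defined by $\mathit{SafetyCl}(\varPhi)(w) = \inf_{u \prec w} \sup_{w' \in \Sigma^\omega} \varPhi(uw')$. *)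

theory Defs
  imports "HOL-Library.Omega_Words_Fun"
begin

text \<open>The alphabet is a type of class \<^class>\<open>finite\<close> (types are nonempty); infinite words over it
  are of type \<^typ>\<open>'a word\<close> and \<open>u \<frown> w\<close> is concatenation. A value domain is a type of class
  \<^class>\<open>complete_lattice\<close> in which \<open>bot \<noteq> top\<close>.\<close>

type_synonym ('a, 'd) property = "'a word \<Rightarrow> 'd"

text \<open>A finite prefix of an infinite word is automatically strict; \<open>u\<close> may be empty.\<close>

definition word_prefix :: "'a list \<Rightarrow> 'a word \<Rightarrow> bool" (infix "\<prec>" 50)
  where "u \<prec> w \<longleftrightarrow> (\<exists>w'. w = u \<frown> w')"

definition safe :: "('a, 'd::complete_lattice) property \<Rightarrow> bool"
  where "safe \<Phi> \<longleftrightarrow>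
    (\<forall>w v. \<not> \<Phi> w \<ge> v \<longrightarrow> (\<exists>u. u \<prec> w \<and> \<not> (SUP w'. \<Phi> (u \<frown> w')) \<ge> v))"

definition SafetyCl :: "('a, 'd::complete_lattice) property \<Rightarrow> ('a, 'd) property"
  where "SafetyCl \<Phi> w = (INF u\<in>{u. u \<prec> w}. SUP w'. \<Phi> (u \<frown> w'))"

end

theory Submission
  imports Defs
begin

text \<open>The supremum of \<open>SafetyCl \<Phi>\<close> over the extensions of \<open>u\<close> is at most that of \<open>\<Phi>\<close>, because
  \<open>u\<close> is itself a prefix of each extension. Hence a prefix refuting \<open>v\<close> for \<open>SafetyCl \<Phi>\<close> is found
  among the terms of the infimum, and safety of \<open>SafetyCl \<Phi>\<close> follows. Conversely, safety of
  \<open>\<Psi>\<close> applied to the value \<open>v = SafetyCl \<Psi> w\<close> gives \<open>SafetyCl \<Psi> w \<le> \<Psi> w\<close>; the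
  remaining claims follow by monotonicity of the closure.\<close>

lemma word_prefix_conc: "u \<prec> u \<frown> w"
  by (auto simp: word_prefix_def)

lemma SafetyCl_le: "u \<prec> w \<Longrightarrow> SafetyCl \<Phi> w \<le> (SUP w'. \<Phi> (u \<frown> w'))"
  unfolding SafetyCl_def by (rule INF_lower) simp

text \<open>Writing \<open>w = u \<frown> w'\<close> shows that \<open>\<Phi> w\<close> is among the
  values in the supremum of every prefix \<open>u\<close>.\<close>

lemma SafetyCl_extensive: "\<Phi> w \<le> SafetyCl \<Phi> w"
  unfolding SafetyCl_def by (rule INF_greatest) (auto simp: word_prefix_def intro: SUP_upper)

lemma SafetyCl_mono:
  assumes "\<And>w. \<Phi> w \<le> \<Psi> w"
  shows "SafetyCl \<Phi> w \<le> SafetyCl \<Psi> w"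
  unfolding SafetyCl_def by (intro INF_mono' SUP_mono' assms)

lemma SUP_SafetyCl_le: "(SUP w'. SafetyCl \<Phi> (u \<frown> w')) \<le> (SUP w'. \<Phi> (u \<frown> w'))"
  by (rule SUP_least) (rule SafetyCl_le[OF word_prefix_conc])

lemma safe_SafetyCl: "safe (SafetyCl \<Phi>)"
  unfolding safe_def
proof (intro allI impI)
  fix w v
  assume "\<not> v \<le> SafetyCl \<Phi> w"
  then obtain u where "u \<prec> w" "\<not> v \<le> (SUP w'. \<Phi> (u \<frown> w'))"
    unfolding SafetyCl_def le_INF_iff by blast
  then show "\<exists>u. u \<prec> w \<and> \<not> v \<le> (SUP w'. SafetyCl \<Phi> (u \<frown> w'))"
    using SUP_SafetyCl_le order_trans by blast
qed

lemma safe_SafetyCl_le: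
  assumes "safe \<Psi>"
  shows "SafetyCl \<Psi> w \<le> \<Psi> w"
  \<comment> \<open>Otherwise safety would yield a prefix of \<open>w\<close> whose supremum is not
    above \<open>SafetyCl \<Psi> w\<close>, contrary to \<open>SafetyCl_le\<close>.\<close>
  using assms SafetyCl_le unfolding safe_def by blast

lemma safe_imp_SafetyCl_eq: "safe \<Psi> \<Longrightarrow> SafetyCl \<Psi> = \<Psi>"
  by (intro ext antisym safe_SafetyCl_le SafetyCl_extensive)

lemma safe_iff_SafetyCl_eq: "safe \<Phi> \<longleftrightarrow> SafetyCl \<Phi> = \<Phi>"
  \<comment> \<open>For the converse, safety of the closure passes to \<open>\<Phi>\<close> along
    the equation.\<close>
  using safe_imp_SafetyCl_eq safe_SafetyCl[of \<Phi>] by auto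

lemma SafetyCl_least:
  assumes "safe \<Psi>" "\<And>w. \<Phi> w \<le> \<Psi> w"
  shows "SafetyCl \<Phi> w \<le> \<Psi> w"
  using SafetyCl_mono[of \<Phi> \<Psi> w] assms by (simp add: safe_imp_SafetyCl_eq)

theorem theorem3p6:
  fixes \<Phi> :: "('a::finite, 'd::complete_lattice) property"
  assumes "(bot :: 'd) \<noteq> top"
  shows "safe (SafetyCl \<Phi>)
    \<and> (\<forall>w. SafetyCl \<Phi> w \<ge> \<Phi> w)
    \<and> (\<forall>w. SafetyCl \<Phi> w = SafetyCl (SafetyCl \<Phi>) w)
    \<and> (safe \<Phi> \<longleftrightarrow> (\<forall>w. \<Phi> w = SafetyCl \<Phi> w))
    \<and> (\<forall>\<Psi> :: ('a, 'd) property. safe \<Psi> \<longrightarrow> (\<forall>w. \<Phi> w \<le> \<Psi> w) \<longrightarrow>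
          (\<forall>w. SafetyCl \<Phi> w \<le> \<Psi> w))"
proof (intro conjI allI impI)
  show "safe (SafetyCl \<Phi>)" by (rule safe_SafetyCl)
  show "\<Phi> w \<le> SafetyCl \<Phi> w" for w by (rule SafetyCl_extensive)
  show "SafetyCl \<Phi> w = SafetyCl (SafetyCl \<Phi>) w" for w
    \<comment> \<open>Being safe, \<open>SafetyCl \<Phi>\<close> is a fixed point of the
      closure.\<close>
    by (simp add: safe_imp_SafetyCl_eq safe_SafetyCl)
  show "safe \<Phi> \<longleftrightarrow> (\<forall>w. \<Phi> w = SafetyCl \<Phi> w)"
    by (auto simp: safe_iff_SafetyCl_eq fun_eq_iff)
  show "SafetyCl \<Phi> w \<le> \<Psi> w" if "safe \<Psi>" "\<forall>w. \<Phi> w \<le> \<Psi> w" for \<Psi> :: "('a, 'd) property" and w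
    using that by (simp add: SafetyCl_least)
qed

end
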